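(* Let $K$ be a field of characteristic $0$ and let $A=K\{x\}$ (or $A=K\{\{x\}\}$), with algebra of constants $A_0=\ker D$. (i) There is a unique Taylor expansion $f=\sum_{j=0}^{\infty}x^j.a_j$ for every $f\in A$, with $a_j=a_j(f)\in A_0$. Moreover, the elements $a_j$ are homogeneous of degree $n-j$ if $f$ is homogeneous of degree $n$. (ii) If $f=\sum_{j=0}^{\infty}x^j.a_j$ is the Taylor expansion of $f$, then the Taylor expansion of $x.f=x\cdot f$ is given by $\sum_{j=1}^{\infty}x^j.a_{j-1}$. (iii) The operator $\Phi$ given by $f\mapsto a_0(f)$ is a projector onto $A_0$ with $\ker\Phi=\operatorname{im}L$.
   Context: $M=M(x)$ is the free magma (without unit) on one generator $x$ (planar binary rooted trees), $\deg$ the number of leaves. $K\{x\}$ is the free unital, not necessarily associative, $K$-algebra on $x$, with basis $M\cup\{1\}$, graded by $\deg$; $K\{\{x\}\}=\prod_nK\{x\}_n$ is its completion. $D=\frac{d}{dx}$ is the (continuous) $K$-linear derivation with $D(x)=1$. $L:A\to A$ is left multiplication by $x$, $L(f)=x\cdot f$; $x^j.f$ denotes $L^j(f)$. For $f\in K\{x\}$ the expansion is a finite sum (all but finitely many $a_j$ vanish); in $K\{\{x\}\}$ infinite sums converge degree-wise. As usual, $0$ is regarded as homogeneous of every degree. *)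

theory Defs
  imports Complex_Main
begin

section \<open>The free magma on one generator and its unital extension\<close>

datatype magma = Gen | Op magma magma

text \<open>
  The basis \<open>M \<union> {1}\<close> is \<^typ>\<open>magma option\<close>, with \<^const>\<open>None\<close> playing the role of the unit.
\<close>

type_synonym word = "magma option"

fun mdeg :: "magma \<Rightarrow> nat" where
  "mdeg Gen = 1"
| "mdeg (Op s t) = mdeg s + mdeg t"

fun deg :: "word \<Rightarrow> nat" where
  "deg None = 0"
| "deg (Some t) = mdeg t"

fun wmult :: "word \<Rightarrow> word \<Rightarrow> word" where
  "wmult None v = v"
| "wmult u None = u"
| "wmult (Some s) (Some t) = Some (Op s t)"

lemma wmult_None2 [simp]: "wmult u None = u"
  by (cases u) auto

lemma deg_wmult [simp]: "deg (wmult u v) = deg u + deg v"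
  by (cases u; cases v) auto

lemma mdeg_pos [simp]: "0 < mdeg t"
  by (induction t) auto

lemma finite_mdeg: "finite {t. mdeg t \<le> n}"
proof (induction n)
  case 0
  have "{t. mdeg t \<le> 0} = {}"
    by (metis (mono_tags) empty_Collect_eq mdeg_pos not_le)
  then show ?case by (metis finite.emptyI)
next
  case (Suc n)
  have "mdeg s \<le> n \<and> mdeg t \<le> n" if "mdeg (Op s t) \<le> Suc n" for s t
    using that mdeg_pos[of s] mdeg_pos[of t] unfolding mdeg.simps by linarith
  then have "t \<in> insert Gen ((\<lambda>(s, t). Op s t) ` ({t. mdeg t \<le> n} \<times> {t. mdeg t \<le> n}))"
    if "mdeg t \<le> Suc n" for t
    using that by (cases t) force+
  then have "{t. mdeg t \<le> Suc n} \<subseteq>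
      insert Gen ((\<lambda>(s, t). Op s t) ` ({t. mdeg t \<le> n} \<times> {t. mdeg t \<le> n}))"
    by blast
  then show ?case
    using Suc by (meson finite_SigmaI finite_imageI finite_insert finite_subset)
qed

lemma finite_deg: "finite {w. deg w \<le> n}"
proof -
  have "{w. deg w \<le> n} \<subseteq> insert None (Some ` {t. mdeg t \<le> n})"
    by (auto simp: image_iff) (metis deg.simps(2) option.exhaust)
  then show ?thesis
    using finite_mdeg by (meson finite_imageI finite_insert finite_subset)
qed

lemma finite_deg_eq [simp]: "finite {w. deg w = n}"
  by (rule finite_subset[OF _ finite_deg[of n]]) auto

lemma finite_factorizations [simp]: "finite {(u, v). wmult u v = w}"
proof -
  have "{(u, v). wmult u v = w} \<subseteq> {u. deg u \<le> deg w} \<times> {v. deg v \<le> deg w}"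
    by auto
  then show ?thesis
    using finite_deg by (meson finite_SigmaI finite_subset)
qed


section \<open>The completed free algebra \<open>K{{x}}\<close> and the subalgebra \<open>K{x}\<close>\<close>

text \<open>
  There are only finitely many words of each degree, so \<open>K{{x}} = \<Prod>\<^sub>n K{x}\<^sub>n\<close> consists of all
  functions from words to \<open>K\<close>; \<open>K{x}\<close> is the subset of finitely supported ones.
\<close>

typedef 'k mseries = "UNIV :: (word \<Rightarrow> 'k) set"
  morphisms coeff Mseries
  by simp

lemma coeff_Mseries [simp]: "coeff (Mseries f) = f"
  by (simp add: Mseries_inverse)

lemma mseries_eq_iff: "f = g \<longleftrightarrow> (\<forall>w. coeff f w = coeff g w)"
  by (metis coeff_inject ext)

instantiation mseries :: (ab_group_add) ab_group_add
begin
definition "0 = Mseries (\<lambda>w. 0)"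
definition "f + g = Mseries (\<lambda>w. coeff f w + coeff g w)"
definition "f - g = Mseries (\<lambda>w. coeff f w - coeff g w)"
definition "- f = Mseries (\<lambda>w. - coeff f w)"
instance
  by standard
    (simp_all add: mseries_eq_iff zero_mseries_def plus_mseries_def minus_mseries_def
      uminus_mseries_def algebra_simps)
end

lemma coeff_simps [simp]:
  "coeff 0 w = 0"
  "coeff (f + g) w = coeff f w + coeff g w"
  "coeff (f - g) w = coeff f w - coeff g w"
  "coeff (- f) w = - coeff f w"
  by (simp_all add: zero_mseries_def plus_mseries_def minus_mseries_def uminus_mseries_def)

lemma coeff_sum [simp]: "coeff (sum f S) w = (\<Sum>i\<in>S. coeff (f i) w)"
  by (induction S rule: infinite_finite_induct) auto

definition monom :: "word \<Rightarrow> 'k::zero_neq_one mseries" where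
  "monom u = Mseries (\<lambda>w. if w = u then 1 else 0)"

instantiation mseries :: (comm_ring_1) "{one, times}"
begin
definition "1 = monom None"
definition "f * g = Mseries (\<lambda>w. \<Sum>(u, v) | wmult u v = w. coeff f u * coeff g v)"
instance ..
end

definition scale :: "'k::comm_ring_1 \<Rightarrow> 'k mseries \<Rightarrow> 'k mseries" where
  "scale c f = Mseries (\<lambda>w. c * coeff f w)"

definition gen :: "'k::comm_ring_1 mseries" where
  "gen = monom (Some Gen)"

definition free_algebra :: "'k::comm_ring_1 mseries set" where
  "free_algebra = {f. finite {w. coeff f w \<noteq> 0}}"

definition completed_algebra :: "'k::comm_ring_1 mseries set" where
  "completed_algebra = UNIV"

text \<open>
  The degree is an integer, so that a homogeneous element of negative degree is 0.
\<close>

definition homogeneous :: "int \<Rightarrow> 'k::comm_ring_1 mseries \<Rightarrow> bool" where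
  "homogeneous d f \<longleftrightarrow> (\<forall>w. coeff f w \<noteq> 0 \<longrightarrow> int (deg w) = d)"

definition L :: "'k::comm_ring_1 mseries \<Rightarrow> 'k mseries" where
  "L f = gen * f"


section \<open>The derivation \<open>D = d/dx\<close>\<close>

fun magma_deriv :: "magma \<Rightarrow> 'k::comm_ring_1 mseries" where
  "magma_deriv Gen = 1"
| "magma_deriv (Op s t) =
     magma_deriv s * monom (Some t) + monom (Some s) * magma_deriv t"

fun word_deriv :: "word \<Rightarrow> 'k::comm_ring_1 mseries" where
  "word_deriv None = 0"
| "word_deriv (Some t) = magma_deriv t"

text \<open>
  Only words of degree \<open>deg w + 1\<close> contribute to the coefficient of \<open>w\<close>, so the linear and
  continuous extension of \<^const>\<open>word_deriv\<close> is given coefficientwise by a finite sum.  That \<open>D\<close> is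
  the unique continuous derivation with \<open>D x = 1\<close> is shown below.
\<close>

definition D :: "'k::comm_ring_1 mseries \<Rightarrow> 'k mseries" where
  "D f = Mseries (\<lambda>w. \<Sum>u | deg u = deg w + 1. coeff f u * coeff (word_deriv u) w)"

lemma coeff_mult: "coeff (f * g) w = (\<Sum>(u, v) | wmult u v = w. coeff f u * coeff g v)"
  by (simp add: times_mseries_def)

lemma coeff_scale [simp]: "coeff (scale c f) w = c * coeff f w"
  by (simp add: scale_def)

lemma coeff_monom [simp]: "coeff (monom u) w = (if w = u then 1 else 0)"
  by (simp add: monom_def)

lemma coeff_D: "coeff (D f) w = (\<Sum>u | deg u = deg w + 1. coeff f u * coeff (word_deriv u) w)"
  by (simp add: D_def)

global_interpretation mseries: vector_space "scale :: 'k::field \<Rightarrow> 'k mseries \<Rightarrow> 'k mseries"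
  by standard (simp_all add: mseries_eq_iff algebra_simps)

lemma mult_add_left: "(f + g) * h = f * h + g * (h :: 'k::comm_ring_1 mseries)"
  by (simp add: mseries_eq_iff coeff_mult algebra_simps sum.distrib case_prod_unfold)

lemma mult_add_right: "h * (f + g) = h * f + h * (g :: 'k::comm_ring_1 mseries)"
  by (simp add: mseries_eq_iff coeff_mult algebra_simps sum.distrib case_prod_unfold)

lemma mult_scale_left: "scale c f * g = scale c (f * g)"
  by (simp add: mseries_eq_iff coeff_mult algebra_simps sum_distrib_left case_prod_unfold)

lemma mult_scale_right: "f * scale c g = scale c (f * g)"
  by (simp add: mseries_eq_iff coeff_mult algebra_simps sum_distrib_left case_prod_unfold)

lemma mult_monom: "monom u * monom v = (monom (wmult u v) :: 'k::comm_ring_1 mseries)"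
proof -
  have "coeff (monom u * monom v) w = coeff (monom (wmult u v) :: 'k mseries) w" for w
  proof -
    have "coeff (monom u * monom v :: 'k mseries) w =
        (\<Sum>p | wmult (fst p) (snd p) = w. if p = (u, v) then 1 else 0)"
      unfolding coeff_mult case_prod_unfold by (rule sum.cong) (auto simp: prod_eq_iff)
    then show ?thesis
      using finite_factorizations[of w] by (simp add: case_prod_unfold sum.delta)
  qed
  then show ?thesis by (simp add: mseries_eq_iff)
qed

lemma mult_zero_left: "0 * f = (0 :: 'k::comm_ring_1 mseries)"
  and mult_zero_right: "f * 0 = (0 :: 'k::comm_ring_1 mseries)"
  by (simp_all add: mseries_eq_iff coeff_mult)

lemma mult_sum_left: "sum F S * g = (\<Sum>i\<in>S. F i * (g :: 'k::comm_ring_1 mseries))"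
  by (induction S rule: infinite_finite_induct) (auto simp: mult_zero_left mult_add_left)

lemma mult_sum_right: "g * sum F S = (\<Sum>i\<in>S. (g :: 'k::comm_ring_1 mseries) * F i)"
  by (induction S rule: infinite_finite_induct) (auto simp: mult_zero_right mult_add_right)

lemma mult_1_left: "1 * f = (f :: 'k::comm_ring_1 mseries)"
proof -
  have "coeff (1 * f) w = coeff f w" for w
  proof -
    have "coeff (1 * f) w =
        (\<Sum>p | wmult (fst p) (snd p) = w. if p = (None, w) then coeff f w else 0)"
      unfolding coeff_mult case_prod_unfold one_mseries_def
      by (rule sum.cong) (auto simp: prod_eq_iff)
    then show ?thesis
      using finite_factorizations[of w] by (simp add: case_prod_unfold sum.delta)
  qed
  then show ?thesis by (simp add: mseries_eq_iff)
qed

lemma mult_1_right: "f * 1 = (f :: 'k::comm_ring_1 mseries)"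
proof -
  have "coeff (f * 1) w = coeff f w" for w
  proof -
    have "coeff (f * 1) w =
        (\<Sum>p | wmult (fst p) (snd p) = w. if p = (w, None) then coeff f w else 0)"
      unfolding coeff_mult case_prod_unfold one_mseries_def
      by (rule sum.cong) (auto simp: prod_eq_iff)
    then show ?thesis
      using finite_factorizations[of w] by (simp add: case_prod_unfold sum.delta)
  qed
  then show ?thesis by (simp add: mseries_eq_iff)
qed

lemma coeff_magma_deriv_eq_0:
  "deg w + 1 \<noteq> mdeg t \<Longrightarrow> coeff (magma_deriv t :: 'k::comm_ring_1 mseries) w = 0"
proof (induction t arbitrary: w)
  case Gen
  then show ?case by (cases w) (auto simp: one_mseries_def)
next
  case (Op s t)
  have "coeff (magma_deriv s * monom (Some t) :: 'k mseries) w = 0"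
    unfolding coeff_mult
  proof (intro sum.neutral ballI, clarsimp)
    fix u assume "w = wmult u (Some t)"
    then show "coeff (magma_deriv s :: 'k mseries) u = 0" using Op by auto
  qed
  moreover have "coeff (monom (Some s) * magma_deriv t :: 'k mseries) w = 0"
    unfolding coeff_mult
  proof (intro sum.neutral ballI, clarsimp)
    fix u assume "w = wmult (Some s) u"
    then show "coeff (magma_deriv t :: 'k mseries) u = 0" using Op by auto
  qed
  ultimately show ?case by simp
qed

lemma coeff_word_deriv_eq_0:
  "deg w + 1 \<noteq> deg u \<Longrightarrow> coeff (word_deriv u :: 'k::comm_ring_1 mseries) w = 0"
  by (cases u) (auto intro: coeff_magma_deriv_eq_0)

lemma D_monom: "D (monom u) = (word_deriv u :: 'k::comm_ring_1 mseries)"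
proof -
  have "coeff (D (monom u)) w = coeff (word_deriv u :: 'k mseries) w" for w
  proof -
    have "coeff (D (monom u) :: 'k mseries) w =
        (\<Sum>v | deg v = deg w + 1. if v = u then coeff (word_deriv u) w else 0)"
      unfolding coeff_D by (rule sum.cong) auto
    then show ?thesis
      using coeff_word_deriv_eq_0[of w u, where ?'k = 'k]
      by (cases "deg u = deg w + 1") (simp_all add: sum.delta)
  qed
  then show ?thesis by (simp add: mseries_eq_iff)
qed

lemma D_add: "D (f + g) = D f + D (g :: 'k::comm_ring_1 mseries)"
  by (simp add: mseries_eq_iff coeff_D algebra_simps sum.distrib)

lemma D_scale: "D (scale c f) = scale c (D f)"
  by (simp add: mseries_eq_iff coeff_D algebra_simps sum_distrib_left)

lemma D_gen: "D gen = (1 :: 'k::comm_ring_1 mseries)"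
  by (simp add: gen_def D_monom)

lemma D_continuous:
  assumes "\<And>w. deg w \<le> n + 1 \<Longrightarrow> coeff f w = coeff g w" and "deg w \<le> n"
  shows "coeff (D f) w = coeff (D g) w"
  unfolding coeff_D by (rule sum.cong) (use assms in auto)

lemma D_sum: "D (sum F S) = (\<Sum>i\<in>S. D (F i) :: 'k::comm_ring_1 mseries)"
proof -
  have "D (0 :: 'k mseries) = 0" by (simp add: mseries_eq_iff coeff_D)
  then show ?thesis
    by (induction S rule: infinite_finite_induct) (auto simp: D_add)
qed

definition truncate :: "nat \<Rightarrow> 'k::comm_ring_1 mseries \<Rightarrow> 'k mseries" where
  "truncate n f = (\<Sum>u | deg u \<le> n. scale (coeff f u) (monom u))"

lemma coeff_truncate: "coeff (truncate n f) w = (if deg w \<le> n then coeff f w else 0)"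
proof -
  have "coeff (truncate n f) w = (\<Sum>u | deg u \<le> n. if u = w then coeff f w else 0)"
    unfolding truncate_def coeff_sum by (rule sum.cong) auto
  then show ?thesis using finite_deg[of n] by (simp add: sum.delta)
qed

lemma mult_continuous:
  assumes "\<And>w. deg w \<le> n \<Longrightarrow> coeff f w = coeff f' w"
    and "\<And>w. deg w \<le> n \<Longrightarrow> coeff g w = coeff g' w" and "deg w \<le> n"
  shows "coeff (f * g) w = coeff (f' * g') w"
  unfolding coeff_mult by (rule sum.cong) (use assms in auto)

lemma D_mult_monom:
  "D (monom u * monom v) = D (monom u) * monom v + monom u * (D (monom v) :: 'k::comm_ring_1 mseries)"
  by (cases u; cases v)
    (simp_all add: mult_monom D_monom mult_zero_left mult_zero_right
      mult_1_left[unfolded one_mseries_def] mult_1_right[unfolded one_mseries_def])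

lemma D_mult: "D (f * g) = D f * g + f * (D g :: 'k::comm_ring_1 mseries)"
proof -
  have poly: "D (truncate n f * truncate n g) =
      D (truncate n f) * truncate n g + truncate n f * D (truncate n g)" for n
    unfolding truncate_def
    by (simp add: mult_sum_left mult_sum_right D_sum mult_scale_left mult_scale_right D_scale
        D_mult_monom mult_add_left mult_add_right mseries_eq_iff sum.distrib
        sum_distrib_left algebra_simps)
  have "coeff (D (f * g)) w = coeff (D f * g + f * D g) w" for w
  proof -
    define n where "n = deg w"
    let ?f = "truncate (n + 1) f" and ?g = "truncate (n + 1) g"
    have tf: "coeff f v = coeff ?f v" and tg: "coeff g v = coeff ?g v" if "deg v \<le> n + 1" for v
      using that by (simp_all add: coeff_truncate)
    have Df: "coeff (D f) v = coeff (D ?f) v" and Dg: "coeff (D g) v = coeff (D ?g) v"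
      if "deg v \<le> n" for v
      using D_continuous[of n f ?f v] D_continuous[of n g ?g v] tf tg that by auto
    have "coeff (D (f * g)) w = coeff (D (?f * ?g)) w"
      by (rule D_continuous[of n], rule mult_continuous[of "n + 1"]) (auto simp: tf tg n_def)
    also have "\<dots> = coeff (D ?f * ?g + ?f * D ?g) w" by (simp only: poly)
    also have "coeff (D ?f * ?g) w = coeff (D f * g) w"
      by (rule mult_continuous[of n]) (auto simp: tg Df n_def)
    moreover have "coeff (?f * D ?g) w = coeff (f * D g) w"
      by (rule mult_continuous[of n]) (auto simp: tf Dg n_def)
    ultimately show ?thesis by simp
  qed
  then show ?thesis by (simp add: mseries_eq_iff)
qed

lemma D_unique:
  fixes d :: "'k::comm_ring_1 mseries \<Rightarrow> 'k mseries"
  assumes add: "\<And>f g. d (f + g) = d f + d g"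
    and scale: "\<And>c f. d (scale c f) = scale c (d f)"
    and mult: "\<And>f g. d (f * g) = d f * g + f * d g"
    and gen: "d gen = 1"
    and cont: "\<And>n. \<exists>m. \<forall>f g. (\<forall>w. deg w \<le> m \<longrightarrow> coeff f w = coeff g w) \<longrightarrow>
      (\<forall>w. deg w \<le> n \<longrightarrow> coeff (d f) w = coeff (d g) w)"
  shows "d = D"
proof -
  have "d (1 * 1) = d 1 * 1 + 1 * d 1" by (rule mult)
  then have d1: "d 1 = 0" by (simp add: mult_1_left mult_1_right)
  have magma: "d (monom (Some t)) = magma_deriv t" for t
  proof (induction t)
    case Gen
    then show ?case using gen by (simp add: gen_def)
  next
    case (Op s t)
    then show ?case using mult[of "monom (Some s)" "monom (Some t)"] by (simp add: mult_monom)
  qed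
  have word: "d (monom u) = D (monom u)" for u
    using d1 magma by (cases u) (auto simp: D_monom one_mseries_def)
  have d0: "d 0 = 0" using add[of 0 0] by simp
  have sum: "d (sum F S) = (\<Sum>i\<in>S. d (F i))" for F :: "word \<Rightarrow> 'k mseries" and S
    by (induction S rule: infinite_finite_induct) (auto simp: d0 add)
  have trunc: "d (truncate m f) = D (truncate m f)" for m f
    unfolding truncate_def by (simp add: sum scale word D_sum D_scale)
  have "coeff (d f) w = coeff (D f) w" for f w
  proof -
    obtain m where m: "\<And>f g. (\<forall>w. deg w \<le> m \<longrightarrow> coeff f w = coeff g w) \<Longrightarrow>
        (\<forall>v. deg v \<le> deg w \<longrightarrow> coeff (d f) v = coeff (d g) v)"
      using cont[of "deg w"] by blast
    define k where "k = max m (deg w + 1)"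
    have "\<forall>v. deg v \<le> m \<longrightarrow> coeff f v = coeff (truncate k f) v"
      by (auto simp: coeff_truncate k_def)
    then have "coeff (d f) w = coeff (d (truncate k f)) w"
      using m by blast
    also have "\<dots> = coeff (D (truncate k f)) w" by (simp only: trunc)
    also have "\<dots> = coeff (D f) w"
      by (rule D_continuous[of "deg w"]) (auto simp: coeff_truncate k_def)
    finally show ?thesis .
  qed
  then show ?thesis by (auto simp: mseries_eq_iff)
qed

section \<open>Taylor expansions\<close>

definition constants :: "'k::comm_ring_1 mseries set \<Rightarrow> 'k mseries set" where
  "constants A = {f \<in> A. D f = 0}"

definition finite_taylor :: "(nat \<Rightarrow> 'k::comm_ring_1 mseries) \<Rightarrow> 'k mseries \<Rightarrow> bool" where
  "finite_taylor a f \<longleftrightarrow>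
     (\<forall>j. a j \<in> constants free_algebra) \<and> finite {j. a j \<noteq> 0} \<and>
     f = (\<Sum>j | a j \<noteq> 0. (L ^^ j) (a j))"

text \<open>
  Degree-wise convergence: in each degree the partial sums are eventually constant.
\<close>

definition sums_degreewise :: "(nat \<Rightarrow> 'k::comm_ring_1 mseries) \<Rightarrow> 'k mseries \<Rightarrow> bool" where
  "sums_degreewise g f \<longleftrightarrow>
     (\<forall>n. \<exists>N. \<forall>m\<ge>N. \<forall>w. deg w = n \<longrightarrow> coeff (\<Sum>j<m. g j) w = coeff f w)"

definition series_taylor :: "(nat \<Rightarrow> 'k::comm_ring_1 mseries) \<Rightarrow> 'k mseries \<Rightarrow> bool" where
  "series_taylor a f \<longleftrightarrow>
     (\<forall>j. a j \<in> constants completed_algebra) \<and> sums_degreewise (\<lambda>j. (L ^^ j) (a j)) f"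

text \<open>
  In the following, \<open>T\<close> is the expansion relation of the algebra at hand, i.e.\ \<^const>\<open>finite_taylor\<close>
  for \<^const>\<open>free_algebra\<close> and \<^const>\<open>series_taylor\<close> for \<^const>\<open>completed_algebra\<close>.
\<close>

definition taylor_coeff ::
  "((nat \<Rightarrow> 'k::comm_ring_1 mseries) \<Rightarrow> 'k mseries \<Rightarrow> bool) \<Rightarrow> 'k mseries \<Rightarrow> nat \<Rightarrow> 'k mseries"
  where "taylor_coeff T f = (THE a. T a f)"

definition projector_onto ::
  "'k::comm_ring_1 mseries set \<Rightarrow> 'k mseries set \<Rightarrow> ('k mseries \<Rightarrow> 'k mseries) \<Rightarrow> bool" where
  "projector_onto A B P \<longleftrightarrow>
     (\<forall>f\<in>A. \<forall>g\<in>A. P (f + g) = P f + P g) \<and>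
     (\<forall>c. \<forall>f\<in>A. P (scale c f) = scale c (P f)) \<and>
     (\<forall>f\<in>A. P (P f) = P f) \<and> P ` A = B"

end

theory Submission
  imports Defs
begin

text \<open>
  Since \<open>D\<close> is a derivation with \<open>D x = 1\<close>, the operators satisfy \<open>D L = 1 + L D\<close>, exactly as in the
  Weyl algebra, although multiplication is not associative.  Everything rests on one consequence: in
  characteristic 0 the degree-preserving operator \<open>D L\<close> is bijective.  It is surjective because
  \<open>\<Sum>\<^sub>k (-1)^k/(k+1)! L^k D^k\<close> is a right inverse by telescoping; and if \<open>D L g = 0\<close>, then repeated
  use of the commutation rule writes \<open>g\<close> as a multiple of \<open>L^k (D^k g)\<close> for every \<open>k\<close>, so that \<open>g\<close>
  starts in arbitrarily high degree and vanishes.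

  Hence every \<open>f\<close> is uniquely \<open>c + L g\<close> with \<open>D c = 0\<close>: solve \<open>D L g = D f\<close> for the quotient \<open>g\<close>
  (lemmas \<open>D_L_quotient\<close> and \<open>decomposition_unique\<close>).  The direct sum \<open>ker D \<oplus> im L\<close> is
  the whole proposition in disguise.  Dividing by \<open>x\<close> with remainder again and again produces the
  Taylor coefficients as the successive remainders, with an error term \<open>L^m g\<close> that lives in degrees
  \<open>\<ge> m\<close>; conversely the remainders are forced (\<open>series_taylor_iff\<close>).  In these terms \<open>\<Phi>\<close> is the
  projection along \<open>im L\<close>, and passing from \<open>f\<close> to \<open>x.f\<close> just prepends a division with remainder 0.

  Restricting a series to a set of degrees commutes with \<open>L\<close> and \<open>D\<close> up to a shift, so by uniqueness
  the decomposition respects degrees.  Applied to a single degree this is homogeneity of the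
  coefficients; applied to bounded degrees it shows that the expansion of a polynomial is
  finite with polynomial coefficients, which reduces \<open>K{x}\<close> to \<open>K{{x}}\<close> (\<open>finite_taylor_iff\<close>).
\<close>

section \<open>The operators \<open>L\<close> and \<open>D\<close>\<close>

lemma L_add: "L (f + g) = L f + L g"
  by (simp add: L_def mult_add_right)

lemma L_scale: "L (scale c f) = scale c (L f)"
  by (simp add: L_def mult_scale_right)

lemma L_zero [simp]: "L 0 = 0"
  by (simp add: L_def mult_zero_right)

lemma L_diff: "L (f - g) = L f - L g"
  using L_add[of "f - g" g] by simp

lemma L_sum: "L (sum F S) = (\<Sum>i\<in>S. L (F i))"
  by (simp add: L_def mult_sum_right)

lemma funpow_L_zero [simp]: "(L ^^ k) 0 = 0"
  by (induction k) simp_all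

lemma funpow_L_add: "(L ^^ k) (f + g) = (L ^^ k) f + (L ^^ k) g"
  by (induction k) (simp_all add: L_add)

lemma funpow_L_scale: "(L ^^ k) (scale c f) = scale c ((L ^^ k) f)"
  by (induction k) (simp_all add: L_scale)

lemma D_zero [simp]: "D 0 = 0"
  using D_add[of 0 0] by simp

lemma D_diff: "D (f - g) = D f - D g"
  using D_add[of "f - g" g] by simp

lemma scale_of_nat_Suc: "scale (of_nat (Suc k)) f = f + scale (of_nat k) f"
  by (simp add: mseries_eq_iff algebra_simps)

lemma D_L: "D (L f) = f + L (D f)"
  by (simp add: L_def D_mult D_gen mult_1_left)

lemma D_L_funpow: "D (L ((L ^^ k) f)) = scale (of_nat (Suc k)) ((L ^^ k) f) + (L ^^ Suc k) (D f)"
proof (induction k)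
  case 0
  then show ?case by (simp add: D_L mseries_eq_iff)
next
  case (Suc k)
  have "D (L ((L ^^ Suc k) f)) = (L ^^ Suc k) f + L (D (L ((L ^^ k) f)))"
    by (simp add: D_L)
  also have "\<dots> = scale (of_nat (Suc (Suc k))) ((L ^^ Suc k) f) + (L ^^ Suc (Suc k)) (D f)"
    unfolding Suc by (simp add: L_add L_scale scale_of_nat_Suc[of "Suc k"] add.assoc del: of_nat_Suc)
  finally show ?case .
qed

section \<open>Degrees\<close>

text \<open>
  Degrees are integers here so that the shifts below need no case distinction in degree 0.
\<close>

definition degree_part :: "(int \<Rightarrow> bool) \<Rightarrow> 'k::comm_ring_1 mseries \<Rightarrow> 'k mseries" where
  "degree_part P f = Mseries (\<lambda>w. if P (int (deg w)) then coeff f w else 0)"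

lemma coeff_degree_part [simp]:
  "coeff (degree_part P f) w = (if P (int (deg w)) then coeff f w else 0)"
  by (simp add: degree_part_def)

lemma degree_part_add: "degree_part P (f + g) = degree_part P f + degree_part P g"
  by (simp add: mseries_eq_iff)

lemma D_degree_part: "D (degree_part P f) = degree_part (\<lambda>d. P (d + 1)) (D f)"
  unfolding mseries_eq_iff
proof
  fix w
  show "coeff (D (degree_part P f)) w = coeff (degree_part (\<lambda>d. P (d + 1)) (D f)) w"
    by (cases "P (int (deg w) + 1)") (auto simp: coeff_D add.commute intro!: sum.neutral sum.cong)
qed

lemma L_degree_part: "L (degree_part P f) = degree_part (\<lambda>d. P (d - 1)) (L f)"
  unfolding mseries_eq_iff
proof
  fix w
  show "coeff (L (degree_part P f)) w = coeff (degree_part (\<lambda>d. P (d - 1)) (L f)) w"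
    by (cases "P (int (deg w) - 1)")
      (auto simp: coeff_mult L_def gen_def intro!: sum.neutral sum.cong)
qed

text \<open>
  One predicate covers homogeneous elements, polynomials of bounded degree and series that start
  in high degree.
\<close>

definition degrees_in :: "(int \<Rightarrow> bool) \<Rightarrow> 'k::comm_ring_1 mseries \<Rightarrow> bool" where
  "degrees_in P f \<longleftrightarrow> degree_part P f = f"

lemma degrees_in_iff: "degrees_in P f \<longleftrightarrow> (\<forall>w. coeff f w \<noteq> 0 \<longrightarrow> P (int (deg w)))"
  by (auto simp: degrees_in_def mseries_eq_iff)

lemma degrees_in_mono: "degrees_in P f \<Longrightarrow> (\<And>d. P d \<Longrightarrow> Q d) \<Longrightarrow> degrees_in Q f"
  by (simp add: degrees_in_iff)

lemma homogeneous_iff: "homogeneous n f \<longleftrightarrow> degrees_in (\<lambda>d. d = n) f"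
  by (simp add: homogeneous_def degrees_in_iff)

lemma degrees_in_L: "degrees_in P f \<Longrightarrow> degrees_in (\<lambda>d. P (d - 1)) (L f)"
  using L_degree_part[of P f] by (simp add: degrees_in_def)

lemma coeff_funpow_L_eq_0: "deg w < k \<Longrightarrow> coeff ((L ^^ k) f) w = 0"
proof -
  have "degrees_in (\<lambda>d. int k \<le> d) ((L ^^ k) f)"
  proof (induction k)
    case 0
    then show ?case by (simp add: degrees_in_iff)
  next
    case (Suc k)
    then have "degrees_in (\<lambda>d. int k \<le> d - 1) ((L ^^ Suc k) f)"
      using degrees_in_L[of "\<lambda>d. int k \<le> d"] by (simp only: funpow.simps(2) o_apply)
    then show ?case
      by (rule degrees_in_mono) simp
  qed
  then show "deg w < k \<Longrightarrow> coeff ((L ^^ k) f) w = 0"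
    by (force simp: degrees_in_iff)
qed

lemma free_algebra_iff: "f \<in> free_algebra \<longleftrightarrow> (\<exists>N. degrees_in (\<lambda>d. d \<le> int N) f)"
proof
  assume "f \<in> free_algebra"
  then have "finite (deg ` {w. coeff f w \<noteq> 0})"
    by (simp add: free_algebra_def)
  then obtain N where "\<forall>n\<in>deg ` {w. coeff f w \<noteq> 0}. n \<le> N"
    by (meson finite_nat_set_iff_bounded_le)
  then show "\<exists>N. degrees_in (\<lambda>d. d \<le> int N) f"
    by (auto simp: degrees_in_iff)
next
  assume "\<exists>N. degrees_in (\<lambda>d. d \<le> int N) f"
  then obtain N where "degrees_in (\<lambda>d. d \<le> int N) f" ..
  then have "{w. coeff f w \<noteq> 0} \<subseteq> {w. deg w \<le> N}"
    by (auto simp: degrees_in_iff)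
  then show "f \<in> free_algebra"
    unfolding free_algebra_def using finite_deg finite_subset by blast
qed

lemma zero_free_algebra: "0 \<in> free_algebra"
  by (simp add: free_algebra_def)

lemma add_free_algebra:
  assumes "f \<in> free_algebra" and "g \<in> free_algebra"
  shows "f + g \<in> free_algebra"
proof -
  have "{w. coeff (f + g) w \<noteq> 0} \<subseteq> {w. coeff f w \<noteq> 0} \<union> {w. coeff g w \<noteq> 0}"
    by auto
  then show ?thesis
    using assms unfolding free_algebra_def by (metis finite_UnI finite_subset mem_Collect_eq)
qed

lemma scale_free_algebra:
  assumes "f \<in> free_algebra"
  shows "scale c f \<in> free_algebra"
proof -
  have "{w. coeff (scale c f) w \<noteq> 0} \<subseteq> {w. coeff f w \<noteq> 0}"
    by auto
  then show ?thesis
    using assms finite_subset by (auto simp: free_algebra_def)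
qed

lemma L_free_algebra: "f \<in> free_algebra \<Longrightarrow> L f \<in> free_algebra"
proof -
  assume "f \<in> free_algebra"
  then obtain N where "degrees_in (\<lambda>d. d \<le> int N) f"
    by (auto simp: free_algebra_iff)
  then have "degrees_in (\<lambda>d. d \<le> int (Suc N)) (L f)"
    by (rule degrees_in_mono[OF degrees_in_L]) simp
  then show ?thesis
    unfolding free_algebra_iff by blast
qed

section \<open>Series whose \<open>k\<close>-th term is divisible by \<open>x^k\<close>\<close>

text \<open>
  A finite sum suffices for each coefficient, because the terms beyond the degree of \<open>w\<close> do not
  reach \<open>w\<close>; this turns convergence into an equation (\<open>sums_degreewise_iff_L_series\<close>).
\<close>

definition L_series :: "(nat \<Rightarrow> 'k::comm_ring_1 mseries) \<Rightarrow> 'k mseries" where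
  "L_series a = Mseries (\<lambda>w. coeff (\<Sum>k\<le>deg w. (L ^^ k) (a k)) w)"

lemma coeff_L_series:
  assumes "deg w < m"
  shows "coeff (L_series a) w = coeff (\<Sum>k<m. (L ^^ k) (a k)) w"
proof -
  have "(\<Sum>k\<le>deg w. coeff ((L ^^ k) (a k)) w) = (\<Sum>k<m. coeff ((L ^^ k) (a k)) w)"
    by (rule sum.mono_neutral_left) (use assms in \<open>auto intro: coeff_funpow_L_eq_0\<close>)
  then show ?thesis
    by (simp add: L_series_def)
qed

lemma coeff_L_L_series:
  assumes "deg w < m"
  shows "coeff (L (L_series a)) w = coeff (L (\<Sum>k<m. (L ^^ k) (a k))) w"
  unfolding L_def[of "L_series a"] L_def[of "\<Sum>k<m. (L ^^ k) (a k)"]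
  by (rule mult_continuous[of "deg w"]) (use assms in \<open>auto intro: coeff_L_series simp del: coeff_sum\<close>)

lemma sums_degreewise_iff_L_series:
  "sums_degreewise (\<lambda>j. (L ^^ j) (a j)) f \<longleftrightarrow> f = L_series a"
proof
  assume f: "sums_degreewise (\<lambda>j. (L ^^ j) (a j)) f"
  show "f = L_series a"
    unfolding mseries_eq_iff
  proof
    fix w
    obtain N where N: "\<And>m. m \<ge> N \<Longrightarrow> coeff (\<Sum>j<m. (L ^^ j) (a j)) w = coeff f w"
      using f unfolding sums_degreewise_def by blast
    show "coeff f w = coeff (L_series a) w"
      using N[of "max N (Suc (deg w))"] coeff_L_series[of w "max N (Suc (deg w))" a] by simp
  qed
next
  assume "f = L_series a"
  then have "coeff (\<Sum>j<m. (L ^^ j) (a j)) w = coeff f w" if "m \<ge> Suc n" "deg w = n" for n m w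
    using coeff_L_series[of w m a] that by simp
  then show "sums_degreewise (\<lambda>j. (L ^^ j) (a j)) f"
    unfolding sums_degreewise_def by blast
qed

lemma L_series_split_first: "L_series a = a 0 + L (L_series (\<lambda>j. a (Suc j)))"
  unfolding mseries_eq_iff
proof
  fix w
  have "coeff (L_series a) w = coeff (\<Sum>k<Suc (Suc (deg w)). (L ^^ k) (a k)) w"
    by (rule coeff_L_series) simp
  also have "\<dots> = coeff (a 0 + L (\<Sum>k<Suc (deg w). (L ^^ k) (a (Suc k)))) w"
    by (simp add: sum.lessThan_Suc_shift[of _ "Suc (deg w)"] L_sum del: sum.lessThan_Suc)
  also have "\<dots> = coeff (a 0 + L (L_series (\<lambda>j. a (Suc j)))) w"
    using coeff_L_L_series[of w "Suc (deg w)" "\<lambda>j. a (Suc j)"]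
    by (simp only: coeff_simps lessI)
  finally show "coeff (L_series a) w = coeff (a 0 + L (L_series (\<lambda>j. a (Suc j)))) w" .
qed

section \<open>Bijectivity of \<open>D L\<close>\<close>

text \<open>
  If \<open>D L g = 0\<close>, then applying \<open>D^k\<close> to \<open>g = - L (D g)\<close> gives \<open>(k+1) D^k g = - L (D^(k+1) g)\<close>, so
  \<open>g\<close> is divisible by every power of \<open>x\<close>.
\<close>

lemma D_L_eq_0_imp_eq_0:
  fixes g :: "'k::field_char_0 mseries"
  assumes "D (L g) = 0"
  shows "g = 0"
proof -
  have step: "scale (of_nat (Suc k)) ((D ^^ k) g) + L ((D ^^ Suc k) g) = 0" for k
  proof (induction k)
    case 0
    then show ?case using assms by (simp add: D_L mseries_eq_iff)
  next
    case (Suc k)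
    have "D (scale (of_nat (Suc k)) ((D ^^ k) g) + L ((D ^^ Suc k) g)) = 0"
      by (simp only: Suc D_zero)
    then show ?case
      by (simp add: D_add D_scale D_L scale_of_nat_Suc[of "Suc k"] add.left_commute add.assoc
          del: of_nat_Suc)
  qed
  have "\<exists>c. g = scale c ((L ^^ k) ((D ^^ k) g))" for k
  proof (induction k)
    case 0
    show ?case by (rule exI[of _ 1]) (simp add: mseries_eq_iff)
  next
    case (Suc k)
    then obtain c where c: "g = scale c ((L ^^ k) ((D ^^ k) g))" ..
    have "(D ^^ k) g = scale (- 1 / of_nat (Suc k)) (L ((D ^^ Suc k) g))"
      unfolding mseries_eq_iff
    proof
      fix w
      have "of_nat (Suc k) * coeff ((D ^^ k) g) w + coeff (L ((D ^^ Suc k) g)) w = 0"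
        using step[of k] unfolding mseries_eq_iff by simp
      moreover have "(of_nat (Suc k) :: 'k) \<noteq> 0"
        by (rule of_nat_neq_0)
      ultimately show "coeff ((D ^^ k) g) w = coeff (scale (- 1 / of_nat (Suc k)) (L ((D ^^ Suc k) g))) w"
        by (simp add: eq_neg_iff_add_eq_0 divide_simps mult.commute del: of_nat_Suc)
    qed
    then have "g = scale c (scale (- 1 / of_nat (Suc k)) ((L ^^ Suc k) ((D ^^ Suc k) g)))"
      using c by (metis funpow_L_scale funpow_Suc_right o_apply)
    then show ?case
      by (metis mseries.scale_scale)
  qed
  note divisible = this
  have "coeff g w = 0" for w
  proof -
    obtain c where "g = scale c ((L ^^ Suc (deg w)) ((D ^^ Suc (deg w)) g))"
      using divisible by blast
    then show ?thesis
      using coeff_funpow_L_eq_0[OF lessI] by (metis coeff_scale mult_not_zero)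
  qed
  then show ?thesis by (simp add: mseries_eq_iff)
qed

text \<open>
  The terms of the right inverse telescope: with \<open>u\<^sub>k = (-1)^k/k! L^k (D^k h)\<close>, the operator \<open>D L\<close> sends
  the \<open>k\<close>-th term to \<open>u\<^sub>k - u\<^sub>k\<^sub>+\<^sub>1\<close>.
\<close>

lemma D_L_surjective:
  fixes h :: "'k::field_char_0 mseries"
  shows "\<exists>g. D (L g) = h"
proof
  define b where "b k = scale ((-1) ^ k / fact (Suc k)) ((D ^^ k) h)" for k
  define u where "u k = scale ((-1) ^ k / fact k) ((L ^^ k) ((D ^^ k) h))" for k
  have telescope: "D (L ((L ^^ k) (b k))) = u k - u (Suc k)" for k
  proof -
    have "D (L ((L ^^ k) (b k))) =
        scale ((-1) ^ k / fact (Suc k))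
          (scale (of_nat (Suc k)) ((L ^^ k) ((D ^^ k) h)) + (L ^^ Suc k) ((D ^^ Suc k) h))"
      unfolding b_def funpow_L_scale L_scale D_scale D_L_funpow by simp
    moreover have "(-1) ^ k / fact (Suc k) * of_nat (Suc k) = ((-1) ^ k / fact k :: 'k)"
      by (simp add: divide_simps del: of_nat_Suc)
    moreover have "(-1) ^ Suc k / fact (Suc k) = - ((-1) ^ k / fact (Suc k) :: 'k)"
      by simp
    ultimately show ?thesis
      by (simp only: u_def mseries.scale_right_distrib mseries.scale_scale mseries.scale_minus_left
          diff_minus_eq_add)
  qed
  show "D (L (L_series b)) = h"
    unfolding mseries_eq_iff
  proof
    fix w
    (* D sees the coefficients in degree deg w + 1, hence one term more than usual. *)
    define m where "m = Suc (Suc (deg w))"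
    have "coeff (D (L (L_series b))) w = coeff (D (L (\<Sum>k<m. (L ^^ k) (b k)))) w"
      by (rule D_continuous[of "deg w"]) (auto intro!: coeff_L_L_series simp: m_def simp del: sum.lessThan_Suc)
    also have "D (L (\<Sum>k<m. (L ^^ k) (b k))) = (\<Sum>k<m. u k - u (Suc k))"
      by (simp add: L_sum D_sum telescope)
    also have "\<dots> = u 0 - u m"
      by (rule sum_lessThan_telescope')
    also have "coeff \<dots> w = coeff h w"
      by (simp add: u_def m_def coeff_funpow_L_eq_0 del: funpow.simps(2))
    finally show "coeff (D (L (L_series b))) w = coeff h w" .
  qed
qed

section \<open>Division by \<open>x\<close> with remainder\<close>

definition quotient :: "'k::field_char_0 mseries \<Rightarrow> 'k mseries" where
  "quotient f = (SOME g. D (L g) = D f)"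

definition remainder :: "'k::field_char_0 mseries \<Rightarrow> 'k mseries" where
  "remainder f = f - L (quotient f)"

lemma D_L_quotient: "D (L (quotient f)) = D f"
  unfolding quotient_def by (rule someI_ex) (rule D_L_surjective)

lemma D_remainder [simp]: "D (remainder f) = 0"
  by (simp add: remainder_def D_diff D_L_quotient)

lemma remainder_plus_L_quotient: "remainder f + L (quotient f) = f"
  by (simp add: remainder_def)

lemma decomposition_unique:
  assumes "D c = 0" and "f = c + L g"
  shows "remainder f = c" and "quotient f = g"
proof -
  have "D (L (quotient f - g)) = 0"
    using assms by (simp add: L_diff D_diff D_L_quotient D_add)
  then have "quotient f - g = 0"
    by (rule D_L_eq_0_imp_eq_0)
  then show "quotient f = g" by simp
  with assms show "remainder f = c" by (simp add: remainder_def)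
qed

lemma division_L: "remainder (L f) = 0" "quotient (L f) = f"
  by (rule decomposition_unique[of 0]; simp)+

lemma remainder_constant: "D c = 0 \<Longrightarrow> remainder c = c"
  by (rule decomposition_unique[of c _ 0]) simp_all

lemma remainder_add: "remainder (f + g) = remainder f + remainder g"
  by (rule decomposition_unique[of _ _ "quotient f + quotient g"])
    (simp_all add: D_add L_add, simp add: remainder_def)

lemma remainder_scale: "remainder (scale c f) = scale c (remainder f)"
proof (rule decomposition_unique[of _ _ "scale c (quotient f)"])
  show "D (scale c (remainder f)) = 0"
    by (simp add: D_scale)
  have "scale c (remainder f + L (quotient f)) = scale c (remainder f) + L (scale c (quotient f))"
    by (simp only: mseries.scale_right_distrib L_scale)
  then show "scale c f = scale c (remainder f) + L (scale c (quotient f))"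
    by (simp only: remainder_plus_L_quotient)
qed

text \<open>
  Cutting \<open>f = c + L g\<close> down to the degrees in which \<open>f\<close> lives gives another decomposition of \<open>f\<close>,
  which is therefore the same one.
\<close>

lemma
  assumes "degrees_in P f"
  shows degrees_in_remainder: "degrees_in P (remainder f)"
    and degrees_in_quotient: "degrees_in (\<lambda>d. P (d + 1)) (quotient f)"
proof -
  have "D (degree_part P (remainder f)) = 0"
    by (simp add: D_degree_part) (simp add: mseries_eq_iff)
  moreover have "f = degree_part P (remainder f) + L (degree_part (\<lambda>d. P (d + 1)) (quotient f))"
    using assms
    by (simp add: L_degree_part degree_part_add[symmetric] remainder_plus_L_quotient degrees_in_def)
  ultimately show "degrees_in P (remainder f)" and "degrees_in (\<lambda>d. P (d + 1)) (quotient f)"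
    using decomposition_unique unfolding degrees_in_def by metis+
qed

lemma degrees_in_funpow_quotient:
  "degrees_in P f \<Longrightarrow> degrees_in (\<lambda>d. P (d + int j)) ((quotient ^^ j) f)"
proof (induction j)
  case (Suc j)
  then show ?case
    using degrees_in_quotient[of "\<lambda>d. P (d + int j)" "(quotient ^^ j) f"] by (simp add: ac_simps)
qed simp

lemma remainder_free_algebra: "f \<in> free_algebra \<Longrightarrow> remainder f \<in> free_algebra"
  by (auto simp: free_algebra_iff intro: degrees_in_remainder)

lemma quotient_free_algebra: "f \<in> free_algebra \<Longrightarrow> quotient f \<in> free_algebra"
proof -
  assume "f \<in> free_algebra"
  then obtain N where "degrees_in (\<lambda>d. d \<le> int N) f"
    by (auto simp: free_algebra_iff)
  then have "degrees_in (\<lambda>d. d \<le> int N) (quotient f)"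
    by (rule degrees_in_mono[OF degrees_in_quotient]) simp
  then show ?thesis
    unfolding free_algebra_iff by blast
qed

section \<open>Taylor expansions by repeated division\<close>

lemma repeated_division:
  "f = (\<Sum>j<m. (L ^^ j) (remainder ((quotient ^^ j) f))) + (L ^^ m) ((quotient ^^ m) f)"
proof (induction m)
  case (Suc m)
  have "(L ^^ m) ((quotient ^^ m) f) =
      (L ^^ m) (remainder ((quotient ^^ m) f) + L ((quotient ^^ Suc m) f))"
    by (simp add: remainder_plus_L_quotient)
  also have "\<dots> = (L ^^ m) (remainder ((quotient ^^ m) f)) + (L ^^ Suc m) ((quotient ^^ Suc m) f)"
    by (simp only: funpow_L_add funpow_Suc_right o_apply)
  finally show ?case
    using Suc by (simp only: sum.lessThan_Suc add.assoc)
qed simp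

text \<open>
  Splitting off the first term of an expansion \<open>f = a\<^sub>0 + L (\<Sum>\<^sub>j x^j.a\<^sub>j\<^sub>+\<^sub>1)\<close> is a division with
  remainder, which determines \<open>a\<^sub>0\<close> and the tail, and the tail is again an expansion.
\<close>

lemma series_taylor_iff:
  "series_taylor a f \<longleftrightarrow> (\<forall>j. a j = remainder ((quotient ^^ j) f))"
proof
  assume "series_taylor a f"
  then have const: "\<And>j. D (a j) = 0" and f: "f = L_series a"
    by (simp_all add: series_taylor_def constants_def sums_degreewise_iff_L_series)
  have split: "L_series (\<lambda>i. a (i + j)) = a j + L (L_series (\<lambda>i. a (i + Suc j)))" for j
    using L_series_split_first[of "\<lambda>i. a (i + j)"] by simp
  have tail: "(quotient ^^ j) f = L_series (\<lambda>i. a (i + j))" for j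
  proof (induction j)
    case (Suc j)
    then show ?case
      using decomposition_unique(2)[OF const split] by simp
  qed (simp add: f)
  show "\<forall>j. a j = remainder ((quotient ^^ j) f)"
    using decomposition_unique(1)[OF const split] by (simp add: tail)
next
  assume a: "\<forall>j. a j = remainder ((quotient ^^ j) f)"
  have "f = L_series a"
    unfolding mseries_eq_iff[of f]
  proof
    fix w
    have "f = (\<Sum>j<Suc (deg w). (L ^^ j) (a j)) + (L ^^ Suc (deg w)) ((quotient ^^ Suc (deg w)) f)"
      using repeated_division[of f "Suc (deg w)"] a by simp
    then have "coeff f w = coeff (\<Sum>j<Suc (deg w). (L ^^ j) (a j)) w
        + coeff ((L ^^ Suc (deg w)) ((quotient ^^ Suc (deg w)) f)) w"
      by (metis coeff_simps(2))
    also have "\<dots> = coeff (\<Sum>j<Suc (deg w). (L ^^ j) (a j)) w"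
      by (simp only: coeff_funpow_L_eq_0 lessI add_0_right)
    also have "\<dots> = coeff (L_series a) w"
      by (rule coeff_L_series[symmetric]) simp
    finally show "coeff f w = coeff (L_series a) w" .
  qed
  moreover have "D (a j) = 0" for j
    using a by simp
  ultimately show "series_taylor a f"
    by (simp add: series_taylor_def constants_def completed_algebra_def
        sums_degreewise_iff_L_series)
qed

lemma degrees_in_taylor:
  fixes f :: "'k::field_char_0 mseries"
  shows "series_taylor a f \<Longrightarrow> degrees_in P f \<Longrightarrow> degrees_in (\<lambda>d. P (d + int j)) (a j)"
  by (simp add: series_taylor_iff degrees_in_remainder degrees_in_funpow_quotient)

lemma L_series_finite:
  assumes "finite {j. a j \<noteq> 0}"
  shows "L_series a = (\<Sum>j | a j \<noteq> 0. (L ^^ j) (a j))"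
  unfolding mseries_eq_iff[of "L_series a"]
proof
  fix w
  obtain m where m: "{j. a j \<noteq> 0} \<subseteq> {..<m}"
    using assms finite_nat_set_iff_bounded by auto
  define M where "M = max m (Suc (deg w))"
  have "coeff (L_series a) w = coeff (\<Sum>j<M. (L ^^ j) (a j)) w"
    by (rule coeff_L_series) (simp add: M_def)
  also have "(\<Sum>j<M. (L ^^ j) (a j)) = (\<Sum>j | a j \<noteq> 0. (L ^^ j) (a j))"
    by (rule sum.mono_neutral_right) (use m in \<open>auto simp: M_def\<close>)
  finally show "coeff (L_series a) w = coeff (\<Sum>j | a j \<noteq> 0. (L ^^ j) (a j)) w" .
qed

text \<open>
  If \<open>f\<close> has degree at most \<open>N\<close>, then \<open>a\<^sub>j\<close> has degree at most \<open>N - j\<close>, hence vanishes for \<open>j > N\<close>.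
\<close>

lemma finite_taylor_iff:
  fixes f :: "'k::field_char_0 mseries"
  shows "finite_taylor a f \<longleftrightarrow> f \<in> free_algebra \<and> series_taylor a f"
proof
  assume *: "finite_taylor a f"
  have "(L ^^ j) (a j) \<in> free_algebra" for j
  proof -
    have "(L ^^ k) (a j) \<in> free_algebra" for k
      by (induction k) (use * in \<open>auto simp: finite_taylor_def constants_def intro: L_free_algebra\<close>)
    then show ?thesis .
  qed
  moreover have "sum F S \<in> free_algebra" if "\<And>j. F j \<in> free_algebra"
    for F :: "nat \<Rightarrow> 'k mseries" and S
    by (induction S rule: infinite_finite_induct)
      (auto simp: that zero_free_algebra intro: add_free_algebra)
  ultimately have "f \<in> free_algebra"
    using * by (simp add: finite_taylor_def)
  moreover have "series_taylor a f"
    using * L_series_finite[of a]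
    by (simp add: finite_taylor_def series_taylor_def sums_degreewise_iff_L_series constants_def
        completed_algebra_def)
  ultimately show "f \<in> free_algebra \<and> series_taylor a f" ..
next
  assume *: "f \<in> free_algebra \<and> series_taylor a f"
  then obtain N where "degrees_in (\<lambda>d. d \<le> int N) f"
    by (auto simp: free_algebra_iff)
  then have deg_a: "degrees_in (\<lambda>d. d + int j \<le> int N) (a j)" for j
    using degrees_in_taylor[of a f "\<lambda>d. d \<le> int N"] * by simp
  then have "degrees_in (\<lambda>d. d \<le> int N) (a j)" for j
    by (rule degrees_in_mono) simp
  then have "a j \<in> free_algebra" for j
    by (auto simp: free_algebra_iff)
  moreover have "{j. a j \<noteq> 0} \<subseteq> {..N}"
    using deg_a by (force simp: degrees_in_iff mseries_eq_iff)
  then have "finite {j. a j \<noteq> 0}"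
    using finite_subset by blast
  ultimately show "finite_taylor a f"
    using * L_series_finite[of a]
    by (simp add: finite_taylor_def series_taylor_def sums_degreewise_iff_L_series constants_def)
qed

theorem proposition2p3:
  fixes A :: "'k::field_char_0 mseries set"
    and T :: "(nat \<Rightarrow> 'k mseries) \<Rightarrow> 'k mseries \<Rightarrow> bool"
  assumes A: "(A = free_algebra \<and> T = finite_taylor) \<or> (A = completed_algebra \<and> T = series_taylor)"
  shows
    "(\<forall>f\<in>A. \<exists>!a. T a f) \<and>
     (\<forall>f\<in>A. \<forall>a. \<forall>n. T a f \<and> homogeneous n f \<longrightarrow> (\<forall>j. homogeneous (n - int j) (a j))) \<and>
     (\<forall>f\<in>A. \<forall>a. T a f \<longrightarrow> T (\<lambda>j. if j = 0 then 0 else a (j - 1)) (L f)) \<and>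
     projector_onto A (constants A) (\<lambda>f. taylor_coeff T f 0) \<and>
     {f\<in>A. taylor_coeff T f 0 = 0} = L ` A"
proof -
  have T: "T a f \<longleftrightarrow> (\<forall>j. a j = remainder ((quotient ^^ j) f))" if "f \<in> A" for a f
    using A that by (auto simp: finite_taylor_iff series_taylor_iff)
  have series: "series_taylor a f" if "T a f" for a f
    using A that by (auto simp: finite_taylor_iff)
  have L_A: "L f \<in> A" if "f \<in> A" for f
    using A that by (auto simp: L_free_algebra completed_algebra_def)
  have remainder_A: "remainder f \<in> A" if "f \<in> A" for f
    using A that by (auto simp: remainder_free_algebra completed_algebra_def)
  have quotient_A: "quotient f \<in> A" if "f \<in> A" for f
    using A that by (auto simp: quotient_free_algebra completed_algebra_def)
  have add_A: "f + g \<in> A" if "f \<in> A" "g \<in> A" for f g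
    using A that by (auto simp: add_free_algebra completed_algebra_def)
  have scale_A: "scale c f \<in> A" if "f \<in> A" for c f
    using A that by (auto simp: scale_free_algebra completed_algebra_def)
  have unique: "\<exists>!a. T a f" if "f \<in> A" for f
    using T[OF that] by (auto simp: fun_eq_iff)
  have Phi: "taylor_coeff T f 0 = remainder f" if "f \<in> A" for f
  proof -
    have "T (taylor_coeff T f) f"
      unfolding taylor_coeff_def by (rule theI'[OF unique[OF that]])
    then show ?thesis
      using T[OF that] by auto
  qed
  have homog: "homogeneous (n - int j) (a j)" if "T a f" "homogeneous n f" for a f n j
    using degrees_in_taylor[OF series[OF that(1)], of "\<lambda>d. d = n" j] that(2)
    by (auto simp: homogeneous_iff degrees_in_iff)
  have shift: "T (\<lambda>j. if j = 0 then 0 else a (j - 1)) (L f)" if "f \<in> A" "T a f" for a f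
  proof -
    have "(quotient ^^ Suc j) (L f) = (quotient ^^ j) f" for j
      by (simp add: funpow_Suc_right division_L del: funpow.simps(2))
    then have "(if j = 0 then 0 else a (j - 1)) = remainder ((quotient ^^ j) (L f))" for j
      using that by (cases j) (simp_all add: T division_L del: funpow.simps(2))
    then show ?thesis
      using T[OF L_A[OF that(1)]] by blast
  qed
  have constants_iff: "c \<in> constants A \<longleftrightarrow> c \<in> A \<and> D c = 0" for c
    by (simp add: constants_def)
  have "(\<lambda>f. taylor_coeff T f 0) ` A = constants A"
  proof
    show "(\<lambda>f. taylor_coeff T f 0) ` A \<subseteq> constants A"
      by (auto simp: constants_iff Phi remainder_A)
    show "constants A \<subseteq> (\<lambda>f. taylor_coeff T f 0) ` A"
    proof
      fix c assume "c \<in> constants A"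
      then have "c \<in> A" "c = taylor_coeff T c 0"
        by (simp_all add: constants_iff Phi remainder_constant)
      then show "c \<in> (\<lambda>f. taylor_coeff T f 0) ` A"
        by blast
    qed
  qed
  then have projector: "projector_onto A (constants A) (\<lambda>f. taylor_coeff T f 0)"
    unfolding projector_onto_def
    by (simp add: Phi add_A scale_A remainder_A remainder_add remainder_scale remainder_constant)
  have kernel: "{f \<in> A. taylor_coeff T f 0 = 0} = L ` A"
  proof
    show "{f \<in> A. taylor_coeff T f 0 = 0} \<subseteq> L ` A"
    proof
      fix f assume "f \<in> {f \<in> A. taylor_coeff T f 0 = 0}"
      then have "f \<in> A" "f = L (quotient f)"
        by (auto simp: Phi remainder_def)
      then show "f \<in> L ` A"
        using quotient_A by blast
    qed
    show "L ` A \<subseteq> {f \<in> A. taylor_coeff T f 0 = 0}"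
      by (auto simp: L_A Phi division_L)
  qed
  show ?thesis
    using unique homog shift projector kernel by blast
qed

end
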